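(* For the admissible couple of splittings of the vector space $\mathcal{F}Cl(S^1,V)$ given by $(\mathcal{F}Cl_+(S^1,V),\mathcal{F}Cl_-(S^1,V))$ and $(\mathcal{F}Cl_{odd}(S^1,V),\mathcal{F}Cl_{even}(S^1,V))$, one has $$\tilde{DV}\big((\mathcal{F}Cl_+(S^1,V),\mathcal{F}Cl_-(S^1,V)),(\mathcal{F}Cl_{odd}(S^1,V),\mathcal{F}Cl_{even}(S^1,V))\big)=2\,Id_{\mathcal{F}Cl(S^1,V)}.$$
   Context: Let $V\cong\mathbb{C}^n$ be a finite-dimensional complex vector space. The space $\mathcal{F}Cl(S^1,V)$ of formal classical pseudo-differential operators is identified with the space of formal symbols $\sigma\sim\sum_{k\in\mathbb{Z},\,k\le d}\sigma_k$ ($d\in\mathbb{Z}$), where each $\sigma_k\in C^\infty(T^*S^1\setminus S^1,M_n(\mathbb{C}))$, $T^*S^1\setminus S^1=\{(x,\xi):\xi\neq0\}$, is positively homogeneous of degree $k$ in $\xi$. Evaluating at $\xi=\pm1$, the subspace $\mathcal{F}Cl^d(S^1,V)$ of symbols of order $\le d$ is identified with the Fréchet space $\prod_{k\le d}C^\infty(S^1,M_n(\mathbb{C}))^2$, and $\mathcal{F}Cl(S^1,V)=\bigcup_d\mathcal{F}Cl^d(S^1,V)$ is a locally convex space, regarded as a diffeological vector space (plots are the maps from open subsets of Euclidean spaces whose composition with every smooth real function is smooth). Define two linear involutions of $\mathcal{F}Cl(S^1,V)$: $$s_{KV}:\sum_k\sigma_k(x,\xi)\mapsto\sum_k(-1)^k\sigma_k(x,-\xi),\qquad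 s_D:\sum_k\sigma_k(x,\xi)\mapsto\frac{\xi}{|\xi|}\sum_k\sigma_k(x,\xi).$$ Set $\mathcal{F}Cl_{odd}=\mathrm{Ker}(Id-s_{KV})$, $\mathcal{F}Cl_{even}=\mathrm{Ker}(Id+s_{KV})$, $\mathcal{F}Cl_+=\mathrm{Ker}(Id-s_D)$, $\mathcal{F}Cl_-=\mathrm{Ker}(Id+s_D)$. A splitting of a diffeological vector space $E$ is a pair $(V',W')$ of subspaces which are the image and kernel of a smooth linear projection of $E$; $p_{(V',W')}$ denotes the projection onto $V'$ parallel to $W'$. A couple of splittings $((V_1,W_1),(V_2,W_2))$ is admissible if $(V_1,W_2)$ and $(V_2,W_1)$ are also splittings. For an admissible couple, set $$DV(V_1,W_1,V_2,W_2)=p_{(V_1,W_2)}\circ p_{(V_2,W_1)}|_{V_1},\qquad \Phi((V_1,W_1),(V_2,W_2))=DV(V_1,W_1,V_2,W_2)\circ p_{(V_1,W_1)},$$ $$\tilde{DV}((V_1,W_1),(V_2,W_2))=\Phi((V_1,W_1),(V_2,W_2))+\Phi((W_1,V_1),(W_2,V_2)).$$ *)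

theory Defs
  imports "HOL-Analysis.Analysis"
begin

section \<open>Smooth maps on open subsets of Euclidean spaces\<close>

text \<open>
  The dimension \<open>m\<close> has to be a value, because plots range over open subsets of
  Euclidean spaces of all dimensions.  Points are functions \<open>nat \<Rightarrow> real\<close> vanishing from
  index \<open>m\<close> on, as in \<^const>\<open>Euclidean_space\<close>; the topology of that space is the one
  induced by the topology of the type \<open>nat \<Rightarrow> real\<close>.
  The definition is the usual one by continuity of all iterated partial derivatives and
  is meant for \<open>U\<close> open in \<open>Euclidean_space m\<close>.
\<close>

primrec Ck_on :: "nat \<Rightarrow> nat \<Rightarrow> (nat \<Rightarrow> real) set \<Rightarrow> ((nat \<Rightarrow> real) \<Rightarrow> 'b::real_normed_vector) \<Rightarrow> bool"
  where
    "Ck_on m 0 U f \<longleftrightarrow> continuous_on U f"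
  | "Ck_on m (Suc k) U f \<longleftrightarrow> continuous_on U f \<and>
       (\<forall>i<m. \<exists>g. (\<forall>x\<in>U. ((\<lambda>t. f (x(i := t))) has_vector_derivative g x) (at (x i))) \<and>
                 Ck_on m k U g)"

definition smooth_on :: "nat \<Rightarrow> (nat \<Rightarrow> real) set \<Rightarrow> ((nat \<Rightarrow> real) \<Rightarrow> 'b::real_normed_vector) \<Rightarrow> bool"
  where "smooth_on m U f \<longleftrightarrow> (\<forall>k. Ck_on m k U f)"

lemma Ck_on_bounded_linear:
  assumes "bounded_linear L" "Ck_on m k U f"
  shows "Ck_on m k U (\<lambda>z. L (f z))"
  using assms(2)
proof (induction k arbitrary: f)
  case 0
  then show ?case
    using bounded_linear.continuous_on[OF assms(1)] by simp
next
  case (Suc k)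
  have "\<exists>g. (\<forall>x\<in>U. ((\<lambda>t. L (f (x(i := t)))) has_vector_derivative g x) (at (x i))) \<and> Ck_on m k U g"
    if i: "i < m" for i
  proof -
    obtain g where g: "\<forall>x\<in>U. ((\<lambda>t. f (x(i := t))) has_vector_derivative g x) (at (x i))" "Ck_on m k U g"
      using Suc.prems i unfolding Ck_on.simps by blast
    then show ?thesis
      using bounded_linear.has_vector_derivative[OF assms(1)] Suc.IH by (intro exI[of _ "\<lambda>x. L (g x)"]) blast
  qed
  moreover have "continuous_on U (\<lambda>z. L (f z))"
    using bounded_linear.continuous_on[OF assms(1)] Suc.prems by auto
  ultimately show ?case by simp
qed

lemma Ck_on_add:
  assumes "Ck_on m k U f" "Ck_on m k U g"
  shows "Ck_on m k U (\<lambda>z. f z + g z)"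
  using assms
proof (induction k arbitrary: f g)
  case 0
  then show ?case by (simp add: continuous_on_add)
next
  case (Suc k)
  have "\<exists>h. (\<forall>x\<in>U. ((\<lambda>t. f (x(i := t)) + g (x(i := t))) has_vector_derivative h x) (at (x i))) \<and> Ck_on m k U h"
    if i: "i < m" for i
  proof -
    obtain f' where f': "\<forall>x\<in>U. ((\<lambda>t. f (x(i := t))) has_vector_derivative f' x) (at (x i))" "Ck_on m k U f'"
      using Suc.prems i unfolding Ck_on.simps by blast
    obtain g' where g': "\<forall>x\<in>U. ((\<lambda>t. g (x(i := t))) has_vector_derivative g' x) (at (x i))" "Ck_on m k U g'"
      using Suc.prems i unfolding Ck_on.simps by blast
    show ?thesis
      using f' g' Suc.IH has_vector_derivative_add
      by (intro exI[of _ "\<lambda>x. f' x + g' x"]) blast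
  qed
  then show ?case
    using Suc.prems by (simp add: continuous_on_add)
qed

lemma Ck_on_zero: "Ck_on m k U (\<lambda>z. 0)"
  by (induction k) (auto intro!: exI[of _ "\<lambda>_. 0"])

section \<open>Smooth functions and seminorms on locally convex spaces\<close>

text \<open>
  Smoothness in the sense of Michal and Bastiani: the iterated directional derivatives
  \<open>d\<^sup>jf (x; v\<^sub>0, \<dots>, v\<^sub>j\<^sub>-\<^sub>1)\<close> exist and are jointly continuous on \<open>E \<times> E\<^sup>j\<close>.
  \<open>D j x v\<close> takes an infinite sequence of directions but, by uniqueness of derivatives,
  depends only on the first \<open>j\<close> of them, so its continuity on \<open>E \<times> E\<^sup>\<nat>\<close> (product
  topology) is continuity on \<open>E \<times> E\<^sup>j\<close>.
\<close>

definition smooth_function :: "('a::{real_vector,topological_space} \<Rightarrow> real) \<Rightarrow> bool"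
  where "smooth_function f \<longleftrightarrow>
    (\<exists>D :: nat \<Rightarrow> 'a \<Rightarrow> (nat \<Rightarrow> 'a) \<Rightarrow> real.
       (\<forall>x v. D 0 x v = f x) \<and>
       (\<forall>j x v. ((\<lambda>t. D j (x + t *\<^sub>R v j) v) has_real_derivative D (Suc j) x v) (at 0)) \<and>
       (\<forall>j. continuous_on UNIV (\<lambda>(x, v). D j x v)))"

definition seminorm :: "('a::real_vector \<Rightarrow> real) \<Rightarrow> bool"
  where "seminorm p \<longleftrightarrow> (\<forall>x y. p (x + y) \<le> p x + p y) \<and> (\<forall>c x. p (c *\<^sub>R x) = \<bar>c\<bar> * p x)"

definition seminorm_topology :: "('a::real_vector \<Rightarrow> real) set \<Rightarrow> 'a topology"
  where "seminorm_topology P = topology (\<lambda>U. \<forall>x\<in>U. \<exists>F \<epsilon>.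
    finite F \<and> F \<subseteq> P \<and> 0 < \<epsilon> \<and> {y. \<forall>p\<in>F. p (y - x) < \<epsilon>} \<subseteq> U)"

lemma openin_seminorm_topology:
  "openin (seminorm_topology P) U \<longleftrightarrow>
    (\<forall>x\<in>U. \<exists>F \<epsilon>. finite F \<and> F \<subseteq> P \<and> 0 < \<epsilon> \<and> {y. \<forall>p\<in>F. p (y - x) < \<epsilon>} \<subseteq> U)"
proof -
  have "istopology (\<lambda>U. \<forall>x\<in>U. \<exists>F \<epsilon>.
    finite F \<and> F \<subseteq> P \<and> 0 < \<epsilon> \<and> {y. \<forall>p\<in>F. p (y - x) < (\<epsilon>::real)} \<subseteq> U)"
    unfolding istopology_def
  proof (intro conjI allI impI ballI, goal_cases)
    case (1 S T x)
    then obtain F \<epsilon> G \<delta> where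
      "finite F" "F \<subseteq> P" "0 < \<epsilon>" "{y. \<forall>p\<in>F. p (y - x) < (\<epsilon>::real)} \<subseteq> S"
      "finite G" "G \<subseteq> P" "0 < \<delta>" "{y. \<forall>p\<in>G. p (y - x) < (\<delta>::real)} \<subseteq> T"
      by (meson IntD1 IntD2)
    then show ?case
      by (intro exI[of _ "F \<union> G"] exI[of _ "min \<epsilon> \<delta>"]) auto
  next
    case (2 \<K> x)
    then obtain K where "K \<in> \<K>" "x \<in> K" by auto
    with 2 show ?case by (meson Union_upper order_trans)
  qed
  then show ?thesis
    unfolding seminorm_topology_def by (simp add: topology_inverse')
qed

section \<open>Diffeologies and splittings\<close>

text \<open>\<open>P m U p\<close>: \<open>p\<close>, defined on the open subset \<open>U\<close> of \<open>\<real>\<^sup>m\<close>, is a plot.\<close>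

type_synonym 'a diffeology = "nat \<Rightarrow> (nat \<Rightarrow> real) set \<Rightarrow> ((nat \<Rightarrow> real) \<Rightarrow> 'a) \<Rightarrow> bool"

definition lcs_diffeology :: "'a::{real_vector,topological_space} diffeology"
  where "lcs_diffeology m U p \<longleftrightarrow>
    openin (Euclidean_space m) U \<and> (\<forall>f. smooth_function f \<longrightarrow> smooth_on m U (f \<circ> p))"

definition diffeo_smooth :: "'a diffeology \<Rightarrow> 'b diffeology \<Rightarrow> ('a \<Rightarrow> 'b) \<Rightarrow> bool"
  where "diffeo_smooth P Q f \<longleftrightarrow> (\<forall>m U p. P m U p \<longrightarrow> Q m U (f \<circ> p))"

type_synonym 'a subspace_pair = "'a set \<times> 'a set"

definition is_projection ::
    "('k::field \<Rightarrow> 'a::ab_group_add \<Rightarrow> 'a) \<Rightarrow> ('a \<Rightarrow> 'a) \<Rightarrow> 'a subspace_pair \<Rightarrow> bool"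
  where "is_projection smul p = (\<lambda>(V, W).
    Vector_Spaces.linear smul smul p \<and> p \<circ> p = p \<and> range p = V \<and> {x. p x = 0} = W)"

definition splitting ::
    "('k::field \<Rightarrow> 'a::ab_group_add \<Rightarrow> 'a) \<Rightarrow> 'a diffeology \<Rightarrow> 'a subspace_pair \<Rightarrow> bool"
  where "splitting smul P S \<longleftrightarrow> (\<exists>p. is_projection smul p S \<and> diffeo_smooth P P p)"

text \<open>A linear projection is determined by its image and kernel, so this is unambiguous.\<close>

definition projection_along ::
    "('k::field \<Rightarrow> 'a::ab_group_add \<Rightarrow> 'a) \<Rightarrow> 'a subspace_pair \<Rightarrow> 'a \<Rightarrow> 'a"
  where "projection_along smul S = (THE p. is_projection smul p S)"

definition admissible_couple ::
    "('k::field \<Rightarrow> 'a::ab_group_add \<Rightarrow> 'a) \<Rightarrow> 'a diffeology \<Rightarrow>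
     'a subspace_pair \<Rightarrow> 'a subspace_pair \<Rightarrow> bool"
  where "admissible_couple smul P = (\<lambda>(V\<^sub>1, W\<^sub>1) (V\<^sub>2, W\<^sub>2).
    splitting smul P (V\<^sub>1, W\<^sub>1) \<and> splitting smul P (V\<^sub>2, W\<^sub>2) \<and>
    splitting smul P (V\<^sub>1, W\<^sub>2) \<and> splitting smul P (V\<^sub>2, W\<^sub>1))"

definition DV ::
    "('k::field \<Rightarrow> 'a::ab_group_add \<Rightarrow> 'a) \<Rightarrow> 'a set \<Rightarrow> 'a set \<Rightarrow> 'a set \<Rightarrow> 'a set \<Rightarrow> 'a \<Rightarrow> 'a"
  where "DV smul V\<^sub>1 W\<^sub>1 V\<^sub>2 W\<^sub>2 = restrict (projection_along smul (V\<^sub>1, W\<^sub>2) \<circ> projection_along smul (V\<^sub>2, W\<^sub>1)) V\<^sub>1"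

definition DV_Phi ::
    "('k::field \<Rightarrow> 'a::ab_group_add \<Rightarrow> 'a) \<Rightarrow> 'a subspace_pair \<Rightarrow> 'a subspace_pair \<Rightarrow> 'a \<Rightarrow> 'a"
  where "DV_Phi smul = (\<lambda>(V\<^sub>1, W\<^sub>1) (V\<^sub>2, W\<^sub>2). DV smul V\<^sub>1 W\<^sub>1 V\<^sub>2 W\<^sub>2 \<circ> projection_along smul (V\<^sub>1, W\<^sub>1))"

definition DV_tilde ::
    "('k::field \<Rightarrow> 'a::ab_group_add \<Rightarrow> 'a) \<Rightarrow> 'a subspace_pair \<Rightarrow> 'a subspace_pair \<Rightarrow> 'a \<Rightarrow> 'a"
  where "DV_tilde smul = (\<lambda>(V\<^sub>1, W\<^sub>1) (V\<^sub>2, W\<^sub>2) x.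
    DV_Phi smul (V\<^sub>1, W\<^sub>1) (V\<^sub>2, W\<^sub>2) x + DV_Phi smul (W\<^sub>1, V\<^sub>1) (W\<^sub>2, V\<^sub>2) x)"

section \<open>Formal classical symbols on the circle\<close>

text \<open>
  \<open>S\<^sup>1 = \<real> / 2\<pi>\<int>\<close>: functions on \<open>T\<^sup>*S\<^sup>1\<close> without its zero section are functions of
  \<open>(x, \<xi>)\<close>, \<open>\<xi> \<noteq> 0\<close>, that are \<open>2\<pi>\<close>-periodic in \<open>x\<close>; since HOL functions are total
  they are given the dummy value \<open>0\<close> at \<open>\<xi> = 0\<close>.  \<open>V = \<complex>\<^sup>n\<close> with \<open>n = CARD('n)\<close>.
\<close>

definition cotangent_domain :: "(nat \<Rightarrow> real) set"
  where "cotangent_domain = {z \<in> topspace (Euclidean_space 2). z 1 \<noteq> 0}"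

definition homogeneous_symbols :: "int \<Rightarrow> (real \<Rightarrow> real \<Rightarrow> complex^'n^'n) set"
  where "homogeneous_symbols k = {f.
    (\<forall>x \<xi>. f (x + 2 * pi) \<xi> = f x \<xi>) \<and>
    smooth_on 2 cotangent_domain (\<lambda>z. f (z 0) (z 1)) \<and>
    (\<forall>x \<xi> t. 0 < t \<and> \<xi> \<noteq> 0 \<longrightarrow> f x (t * \<xi>) = (t powi k) *\<^sub>R f x \<xi>) \<and>
    (\<forall>x. f x 0 = 0)}"

lemma homogeneous_symbols_zero: "(\<lambda>x \<xi>. 0) \<in> homogeneous_symbols k"
  by (simp add: homogeneous_symbols_def smooth_on_def Ck_on_zero)

lemma homogeneous_symbols_bounded_linear:
  assumes "bounded_linear L" "f \<in> homogeneous_symbols k"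
  shows "(\<lambda>x \<xi>. L (f x \<xi>)) \<in> homogeneous_symbols k"
proof -
  have "Ck_on 2 j cotangent_domain (\<lambda>z. L (f (z 0) (z 1)))" for j
    using assms(2)
    by (intro Ck_on_bounded_linear[OF assms(1)]) (simp add: homogeneous_symbols_def smooth_on_def)
  then show ?thesis
    using assms(2) linear_scale[OF bounded_linear.linear[OF assms(1)]]
      linear_0[OF bounded_linear.linear[OF assms(1)]]
    by (simp add: homogeneous_symbols_def smooth_on_def)
qed

lemma homogeneous_symbols_add:
  assumes "f \<in> homogeneous_symbols k" "g \<in> homogeneous_symbols k"
  shows "(\<lambda>x \<xi>. f x \<xi> + g x \<xi>) \<in> homogeneous_symbols k"
  using assms by (simp add: homogeneous_symbols_def smooth_on_def scaleR_add_right Ck_on_add)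

lemma Ck_on_reflect:
  assumes "Ck_on 2 k cotangent_domain f"
  shows "Ck_on 2 k cotangent_domain (\<lambda>z. f (z(1 := - z 1)))"
  using assms
proof (induction k arbitrary: f)
  have cont: "continuous_on cotangent_domain (\<lambda>z. f (z(1 := - z 1)))"
    if "continuous_on cotangent_domain f" for f :: "(nat \<Rightarrow> real) \<Rightarrow> 'a"
  proof (rule continuous_on_compose2[OF that])
    have "continuous_on cotangent_domain (\<lambda>z::nat \<Rightarrow> real. (z(1 := - z 1)) i)" for i
    proof -
      have c: "continuous_on cotangent_domain (\<lambda>z::nat \<Rightarrow> real. z i)" for i
        by (rule continuous_on_subset[OF continuous_on_product_coordinates]) simp
      then show ?thesis
        using continuous_on_minus[OF c[of 1]] by (cases "i = 1") simp_all
    qed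
    then show "continuous_on cotangent_domain (\<lambda>z::nat \<Rightarrow> real. z(1 := - z 1))"
      by (rule continuous_on_coordinatewise_then_product)
  qed (auto simp: cotangent_domain_def topspace_Euclidean_space)
  {
    case 0
    from cont[OF 0[unfolded Ck_on.simps]] show ?case unfolding Ck_on.simps .
  next
    case (Suc k)
    have "\<exists>h. (\<forall>x\<in>cotangent_domain. ((\<lambda>t. f ((x(i := t))(1 := - (x(i := t)) 1)))
        has_vector_derivative h x) (at (x i))) \<and> Ck_on 2 k cotangent_domain h"
      if i: "i < 2" for i
    proof -
      obtain g where g: "\<And>x. x\<in>cotangent_domain \<Longrightarrow>
          ((\<lambda>t. f (x(i := t))) has_vector_derivative g x) (at (x i))" "Ck_on 2 k cotangent_domain g"
        using Suc.prems i unfolding Ck_on.simps by blast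
      have R: "x(1 := - x 1) \<in> cotangent_domain" if "x \<in> cotangent_domain" for x
        using that by (auto simp: cotangent_domain_def topspace_Euclidean_space)
      consider "i = 0" | "i = 1" using i by linarith
      then show ?thesis
      proof cases
        case 1
        have "((\<lambda>t. f ((x(0 := t))(1 := - (x(0 := t)) 1))) has_vector_derivative g (x(1 := - x 1))) (at (x 0))"
          if "x \<in> cotangent_domain" for x
        proof -
          have "(x(0 := t))(1 := - (x(0 := t)) 1) = (x(1 := - x 1))(0 := t)" for t
            by (simp add: fun_eq_iff)
          then show ?thesis
            using g(1)[OF R[OF that]] 1 by simp
        qed
        then show ?thesis
          using Suc.IH[OF g(2)] unfolding 1 by (intro exI[of _ "\<lambda>x. g (x(1 := - x 1))"] conjI ballI)
      next
        case 2
        have "((\<lambda>t. f ((x(1 := t))(1 := - (x(1 := t)) 1))) has_vector_derivative - g (x(1 := - x 1))) (at (x 1))"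
          if "x \<in> cotangent_domain" for x
        proof -
          have "((\<lambda>t. f (x(1 := t))) has_vector_derivative g (x(1 := - x 1))) (at (- x 1))"
            using g(1)[OF R[OF that]] unfolding 2 fun_upd_upd fun_upd_same .
          moreover have "((\<lambda>t. - t) has_vector_derivative (- 1)) (at (x 1))"
            by (auto intro!: derivative_eq_intros)
          ultimately have "(((\<lambda>t. f (x(1 := t))) \<circ> (\<lambda>t. - t)) has_vector_derivative
              (- 1) *\<^sub>R g (x(1 := - x 1))) (at (x 1))"
            by (rule vector_diff_chain_at[rotated])
          then show ?thesis by (simp add: o_def)
        qed
        moreover have "Ck_on 2 k cotangent_domain (\<lambda>x. - g (x(1 := - x 1)))"
          using Ck_on_bounded_linear[OF bounded_linear_minus[OF bounded_linear_ident] Suc.IH[OF g(2)]] .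
        ultimately show ?thesis
          unfolding 2 by (intro exI[of _ "\<lambda>x. - g (x(1 := - x 1))"] conjI ballI)
      qed
    qed
    moreover have "continuous_on cotangent_domain f"
      using Suc.prems unfolding Ck_on.simps by (rule conjunct1)
    ultimately show ?case
      unfolding Ck_on.simps by (intro conjI allI impI cont)
  }
qed

lemma Ck_on_sign:
  assumes "Ck_on 2 k cotangent_domain f"
  shows "Ck_on 2 k cotangent_domain (\<lambda>z. (z 1 / \<bar>z 1\<bar>) *\<^sub>R f z)"
  using assms
proof (induction k arbitrary: f)
  have cont: "continuous_on cotangent_domain (\<lambda>z. (z 1 / \<bar>z 1\<bar>) *\<^sub>R f z)"
    if "continuous_on cotangent_domain f" for f :: "(nat \<Rightarrow> real) \<Rightarrow> 'a"
  proof -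
    have "continuous_on cotangent_domain (\<lambda>z::nat \<Rightarrow> real. z 1)"
      by (rule continuous_on_subset[OF continuous_on_product_coordinates]) simp
    then show ?thesis
      using that by (intro continuous_on_scaleR continuous_on_divide continuous_on_rabs)
        (auto simp: cotangent_domain_def)
  qed
  {
    case 0
    from cont[OF 0[unfolded Ck_on.simps]] show ?case unfolding Ck_on.simps .
  next
    case (Suc k)
    have "\<exists>h. (\<forall>x\<in>cotangent_domain. ((\<lambda>t. ((x(i := t)) 1 / \<bar>(x(i := t)) 1\<bar>) *\<^sub>R f (x(i := t)))
        has_vector_derivative h x) (at (x i))) \<and> Ck_on 2 k cotangent_domain h"
      if i: "i < 2" for i
    proof -
      obtain g where g: "\<And>x. x\<in>cotangent_domain \<Longrightarrow>
          ((\<lambda>t. f (x(i := t))) has_vector_derivative g x) (at (x i))" "Ck_on 2 k cotangent_domain g"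
        using Suc.prems i unfolding Ck_on.simps by blast
      have "((\<lambda>t. ((x(i := t)) 1 / \<bar>(x(i := t)) 1\<bar>) *\<^sub>R f (x(i := t)))
          has_vector_derivative (x 1 / \<bar>x 1\<bar>) *\<^sub>R g x) (at (x i))" if x: "x \<in> cotangent_domain" for x
      proof -
        have d: "((\<lambda>t. (x 1 / \<bar>x 1\<bar>) *\<^sub>R f (x(i := t)))
            has_vector_derivative (x 1 / \<bar>x 1\<bar>) *\<^sub>R g x) (at (x i))"
          using bounded_linear.has_vector_derivative[OF bounded_linear_scaleR_right g(1)[OF x]] .
        define S where "S = (if i = 1 then if x 1 > 0 then {0<..} else {..<0} else (UNIV :: real set))"
        have x1: "x 1 \<noteq> 0" using x by (simp add: cotangent_domain_def)
        have S: "open S" "x i \<in> S" using x1 by (auto simp: S_def)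
        have eq: "(x 1 / \<bar>x 1\<bar>) *\<^sub>R f (x(i := t)) = ((x(i := t)) 1 / \<bar>(x(i := t)) 1\<bar>) *\<^sub>R f (x(i := t))"
          if "t \<in> S" for t
          using that x1 by (auto simp: S_def split: if_splits)
        show ?thesis
          by (rule has_vector_derivative_transform_within_open[OF d S eq])
      qed
      then show ?thesis
        using Suc.IH[OF g(2)] by (intro exI[of _ "\<lambda>x. (x 1 / \<bar>x 1\<bar>) *\<^sub>R g x"] conjI ballI)
    qed
    moreover have "continuous_on cotangent_domain f"
      using Suc.prems unfolding Ck_on.simps by (rule conjunct1)
    ultimately show ?case
      unfolding Ck_on.simps by (intro conjI allI impI cont)
  }
qed

lemma homogeneous_symbols_reflect:
  assumes "f \<in> homogeneous_symbols k"
  shows "(\<lambda>x \<xi>. f x (- \<xi>)) \<in> homogeneous_symbols k"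
proof -
  have h: "\<forall>x \<xi> t. 0 < t \<and> \<xi> \<noteq> 0 \<longrightarrow> f x (t * \<xi>) = (t powi k) *\<^sub>R f x \<xi>"
    using assms by (simp add: homogeneous_symbols_def)
  have "f x (- (t * \<xi>)) = (t powi k) *\<^sub>R f x (- \<xi>)" if "0 < t" "\<xi> \<noteq> 0" for x \<xi> t
    using h[rule_format, of t "- \<xi>" x] that by simp
  moreover have "Ck_on 2 j cotangent_domain (\<lambda>z. f (z 0) (- z 1))" for j
    using Ck_on_reflect[of j "\<lambda>z. f (z 0) (z 1)"] assms
    by (simp add: homogeneous_symbols_def smooth_on_def)
  ultimately show ?thesis
    using assms by (simp add: homogeneous_symbols_def smooth_on_def)
qed

lemma homogeneous_symbols_sign:
  assumes "f \<in> homogeneous_symbols k"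
  shows "(\<lambda>x \<xi>. (\<xi> / \<bar>\<xi>\<bar>) *\<^sub>R f x \<xi>) \<in> homogeneous_symbols k"
proof -
  have h: "\<forall>x \<xi> t. 0 < t \<and> \<xi> \<noteq> 0 \<longrightarrow> f x (t * \<xi>) = (t powi k) *\<^sub>R f x \<xi>"
    using assms by (simp add: homogeneous_symbols_def)
  have "((t * \<xi>) / \<bar>t * \<xi>\<bar>) *\<^sub>R f x (t * \<xi>) = (t powi k) *\<^sub>R (\<xi> / \<bar>\<xi>\<bar>) *\<^sub>R f x \<xi>"
    if "0 < t" "\<xi> \<noteq> 0" for x \<xi> t
    using h[rule_format, of t \<xi> x] that by (simp add: abs_mult mult.commute)
  moreover have "Ck_on 2 j cotangent_domain (\<lambda>z. (z 1 / \<bar>z 1\<bar>) *\<^sub>R f (z 0) (z 1))" for j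
    using Ck_on_sign[of j "\<lambda>z. f (z 0) (z 1)"] assms
    by (simp add: homogeneous_symbols_def smooth_on_def)
  ultimately show ?thesis
    using assms by (simp add: homogeneous_symbols_def smooth_on_def)
qed

typedef ('n::finite) FCl = "{\<sigma> :: int \<Rightarrow> real \<Rightarrow> real \<Rightarrow> complex^'n^'n.
    (\<forall>k. \<sigma> k \<in> homogeneous_symbols k) \<and> (\<exists>d. \<forall>k>d. \<sigma> k = (\<lambda>x \<xi>. 0))}"
  morphisms symbol_component Abs_FCl
  by (intro exI[of _ "\<lambda>k x \<xi>. 0"]) (auto simp: homogeneous_symbols_zero)

setup_lifting type_definition_FCl

lemma bounded_linear_map_matrix_times: "bounded_linear (map_matrix ((*) (c::complex)) :: complex^'n^'n \<Rightarrow> _)"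
  by (auto intro!: linear_linear[THEN iffD2] linearI
      simp: vec_eq_iff linear_conv_bounded_linear[symmetric] distrib_left)

lift_definition FCl_scale :: "complex \<Rightarrow> 'n::finite FCl \<Rightarrow> 'n FCl"
  is "\<lambda>c \<sigma> k x \<xi>. map_matrix ((*) c) (\<sigma> k x \<xi>)"
proof (intro conjI allI, goal_cases)
  case (2 c \<sigma>)
  then obtain d where "\<forall>k>d. \<sigma> k = (\<lambda>x \<xi>. 0)" by auto
  then show ?case by (intro exI[of _ d]) (simp add: vec_eq_iff fun_eq_iff)
qed (auto intro: homogeneous_symbols_bounded_linear[OF bounded_linear_map_matrix_times])

instantiation FCl :: (finite) real_vector
begin

lift_definition zero_FCl :: "'a FCl" is "\<lambda>k x \<xi>. 0"
  by (simp add: homogeneous_symbols_zero)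

lift_definition plus_FCl :: "'a FCl \<Rightarrow> 'a FCl \<Rightarrow> 'a FCl" is "\<lambda>\<sigma> \<tau> k x \<xi>. \<sigma> k x \<xi> + \<tau> k x \<xi>"
proof (intro conjI allI, goal_cases)
  case (2 \<sigma> \<tau>)
  then obtain d e where "\<forall>k>d. \<sigma> k = (\<lambda>x \<xi>. 0)" "\<forall>k>e. \<tau> k = (\<lambda>x \<xi>. 0)" by auto
  then show ?case by (intro exI[of _ "max d e"]) auto
qed (auto intro: homogeneous_symbols_add)

lift_definition uminus_FCl :: "'a FCl \<Rightarrow> 'a FCl" is "\<lambda>\<sigma> k x \<xi>. - \<sigma> k x \<xi>"
proof (intro conjI allI, goal_cases)
  case (2 \<sigma>)
  then obtain d where "\<forall>k>d. \<sigma> k = (\<lambda>x \<xi>. 0)" by auto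
  then show ?case by (intro exI[of _ d]) simp
qed (auto intro: homogeneous_symbols_bounded_linear[OF bounded_linear_minus[OF bounded_linear_ident]])

lift_definition scaleR_FCl :: "real \<Rightarrow> 'a FCl \<Rightarrow> 'a FCl" is "\<lambda>c \<sigma> k x \<xi>. c *\<^sub>R \<sigma> k x \<xi>"
proof (intro conjI allI, goal_cases)
  case (2 c \<sigma>)
  then obtain d where "\<forall>k>d. \<sigma> k = (\<lambda>x \<xi>. 0)" by auto
  then show ?case by (intro exI[of _ d]) simp
qed (auto intro: homogeneous_symbols_bounded_linear[OF bounded_linear_scaleR_right])

definition minus_FCl :: "'a FCl \<Rightarrow> 'a FCl \<Rightarrow> 'a FCl"
  where "minus_FCl \<sigma> \<tau> = \<sigma> + - \<tau>"

instance
  by (standard; (unfold minus_FCl_def)?; transfer) (auto simp: algebra_simps fun_eq_iff)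

end

lemma vector_space_FCl_scale: "vector_space (FCl_scale :: complex \<Rightarrow> 'n::finite FCl \<Rightarrow> 'n FCl)"
  by (unfold_locales; transfer) (auto simp: fun_eq_iff vec_eq_iff algebra_simps)

lemma FCl_scale_of_real: "FCl_scale (of_real c) \<sigma> = c *\<^sub>R \<sigma>"
  by transfer (auto simp: fun_eq_iff vec_eq_iff scaleR_conv_of_real[where 'a = complex])

subsection \<open>Topology and diffeology\<close>

definition FCl_order :: "int \<Rightarrow> 'n::finite FCl set"
  where "FCl_order d = {\<sigma>. \<forall>k>d. symbol_component \<sigma> k = (\<lambda>x \<xi>. 0)}"

text \<open>
  The seminorms of \<open>\<Prod>\<^sub>k C\<^sup>\<infinity>(S\<^sup>1, M\<^sub>n(\<complex>))\<^sup>2\<close>: suprema of the \<open>j\<close>-th \<open>x\<close>-derivative of the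
  \<open>k\<close>-th component at \<open>\<xi> = \<plusminus>1\<close>.  Those with \<open>k > d\<close> vanish on \<open>FCl_order d\<close>, so all of
  them together induce on it its Frechet topology.
\<close>

definition FCl_seminorm :: "int \<Rightarrow> nat \<Rightarrow> real \<Rightarrow> 'n::finite FCl \<Rightarrow> real"
  where "FCl_seminorm k j s \<sigma> = (SUP x\<in>{0..2 * pi}.
    norm (((\<lambda>f x. vector_derivative f (at x)) ^^ j) (\<lambda>x. symbol_component \<sigma> k x s) x))"

definition FCl_order_topology :: "int \<Rightarrow> 'n::finite FCl topology"
  where "FCl_order_topology d = subtopology
    (seminorm_topology {FCl_seminorm k j s | k j s. s \<in> {1, - 1}}) (FCl_order d)"

text \<open>
  The union over \<open>d\<close> carries the locally convex inductive limit topology: the finest locally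
  convex topology for which all the inclusions of the \<open>FCl_order d\<close> are continuous.
\<close>

instantiation FCl :: (finite) topological_space
begin

definition open_FCl :: "'a FCl set \<Rightarrow> bool"
  where "open_FCl = openin (seminorm_topology
    {p. seminorm p \<and> (\<forall>d. continuous_map (FCl_order_topology d) euclideanreal p)})"

instance
proof
  show "open (UNIV :: 'a FCl set)"
    unfolding open_FCl_def openin_seminorm_topology
    by (intro ballI exI[of _ "{}"] exI[of _ "1 :: real"]) simp
next
  show "open (S \<inter> T)" if "open S" "open T" for S T :: "'a FCl set"
    using that unfolding open_FCl_def by (rule openin_Int)
next
  show "open (\<Union> K)" if "\<forall>S\<in>K. open S" for K :: "'a FCl set set"
    using that unfolding open_FCl_def by (intro openin_Union) blast
qed

end

subsection \<open>The involutions and their eigenspaces\<close>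

lift_definition s_KV :: "'n::finite FCl \<Rightarrow> 'n FCl"
  is "\<lambda>\<sigma> k x \<xi>. ((- 1) powi k) *\<^sub>R \<sigma> k x (- \<xi>)"
proof (intro conjI allI, goal_cases)
  case (2 \<sigma>)
  then obtain d where "\<forall>k>d. \<sigma> k = (\<lambda>x \<xi>. 0)" by auto
  then show ?case by (intro exI[of _ d]) simp
qed (auto intro: homogeneous_symbols_bounded_linear[OF bounded_linear_scaleR_right
      homogeneous_symbols_reflect])

lift_definition s_D :: "'n::finite FCl \<Rightarrow> 'n FCl"
  is "\<lambda>\<sigma> k x \<xi>. (\<xi> / \<bar>\<xi>\<bar>) *\<^sub>R \<sigma> k x \<xi>"
proof (intro conjI allI, goal_cases)
  case (2 \<sigma>)
  then obtain d where "\<forall>k>d. \<sigma> k = (\<lambda>x \<xi>. 0)" by auto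
  then show ?case by (intro exI[of _ d]) simp
qed (auto intro: homogeneous_symbols_sign)

definition FCl_odd :: "'n::finite FCl set"
  where "FCl_odd = {\<sigma>. \<sigma> - s_KV \<sigma> = 0}"

definition FCl_even :: "'n::finite FCl set"
  where "FCl_even = {\<sigma>. \<sigma> + s_KV \<sigma> = 0}"

definition FCl_plus :: "'n::finite FCl set"
  where "FCl_plus = {\<sigma>. \<sigma> - s_D \<sigma> = 0}"

definition FCl_minus :: "'n::finite FCl set"
  where "FCl_minus = {\<sigma>. \<sigma> + s_D \<sigma> = 0}"

end

theory Submission
  imports Defs
begin

text \<open>
  Write \<open>D\<close> for \<^const>\<open>s_D\<close> and \<open>S\<close> for \<^const>\<open>s_KV\<close>.  Both are linear involutions, and they
  anticommute: \<open>S\<close> evaluates at \<open>- \<xi>\<close>, which reverses the factor \<open>\<xi> / \<bar>\<xi>\<bar>\<close> of \<open>D\<close>.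
  Everything else about symbols enters only through continuity.

  The algebra is that of two anticommuting involutions.  The projection onto \<open>Ker (1 - D)\<close>
  parallel to \<open>Ker (1 + D)\<close> is \<open>(1 + D) / 2\<close>.  The projection onto \<open>Ker (1 - D)\<close> parallel to
  \<open>Ker (1 + S)\<close> is \<open>(1 + D)(1 + S) / 2\<close>: if \<open>D x = x\<close>, then \<open>S x\<close> lies in
  \<open>Ker (1 + D)\<close>, so that \<open>x\<close> is fixed; and no nonzero vector \<open>u = (1 + S) x\<close> is killed by
  \<open>1 + D\<close>, because it would satisfy \<open>S u = u\<close> and \<open>D u = - u\<close>, whence
  \<open>- u = S D u = - D S u = u\<close>.  On \<open>Ker (1 - D)\<close> the projection
  \<open>(1 + S)(1 + D) / 2\<close> is \<open>1 + S\<close>, and \<open>(1 + S)\<^sup>2 = 2 (1 + S)\<close>, so the double projection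
  \<open>DV\<close> is multiplication by \<open>2\<close> there.  The same holds on \<open>Ker (1 + D)\<close>, because
  \<open>- D\<close> and \<open>- S\<close> are again anticommuting involutions; adding the two halves gives
  \<open>(1 + D) + (1 - D) = 2\<close>.

  For admissibility the four projections, all of them polynomials in \<open>D\<close> and \<open>S\<close>, have to be
  smooth.  Smooth functions are preserved by composition with a continuous linear map, so
  continuity suffices, and for this it is enough that composition with \<open>D\<close> and with \<open>S\<close>
  preserves the set of seminorms that define the inductive limit topology.  Now
  \<open>D\<close> multiplies the restrictions of the components to \<open>\<xi> = \<plusminus>1\<close> by signs,
  and \<open>S\<close> exchanges them up to signs; hence both merely permute the
  seminorms of the Frechet spaces of symbols of bounded order.
\<close>

section \<open>Projections attached to anticommuting involutions\<close>

lemma is_projection_unique: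
  assumes p: "is_projection smul p S" and q: "is_projection smul q S"
  shows "p = q"
proof
  fix x
  obtain V W where S: "S = (V, W)" by (cases S)
  interpret p: Vector_Spaces.linear smul smul p
    using p by (simp add: is_projection_def S)
  interpret q: Vector_Spaces.linear smul smul q
    using q by (simp add: is_projection_def S)
  have idem: "p (p y) = p y" "q (q y) = q y" for y
    using p q by (simp_all add: is_projection_def S fun_eq_iff)
  have ranges: "range p = V" "range q = V" and kernels: "{x. p x = 0} = W" "{x. q x = 0} = W"
    using p q by (simp_all add: is_projection_def S)
  have "x - p x \<in> W"
    unfolding kernels(1)[symmetric] by (simp add: p.diff idem)
  then have "q x = q (p x)"
    unfolding kernels(2)[symmetric] by (simp add: q.diff)
  moreover have "p x \<in> range q"
    using ranges by auto
  ultimately show "p x = q x"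
    using idem(2) by auto
qed

lemma projection_along_eq:
  assumes "is_projection smul p S"
  shows "projection_along smul S = p"
  unfolding projection_along_def using assms is_projection_unique by blast

locale anticommuting_involutions = vector_space smul
  for smul :: "'k::field_char_0 \<Rightarrow> 'a::ab_group_add \<Rightarrow> 'a" +
  fixes D S :: "'a \<Rightarrow> 'a"
  assumes linear_D: "Vector_Spaces.linear smul smul D"
    and linear_S: "Vector_Spaces.linear smul smul S"
    and D_D: "D (D x) = x"
    and S_S: "S (S x) = x"
    and S_D: "S (D x) = - D (S x)"
begin

sublocale D: Vector_Spaces.linear smul smul D by (rule linear_D)
sublocale S: Vector_Spaces.linear smul smul S by (rule linear_S)

lemma half_add_half: "smul (1/2) x + smul (1/2) x = x"
  by (simp flip: scale_left_distrib)

lemma half_double: "smul (1/2) (x + x) = x"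
  by (simp add: scale_right_distrib half_add_half)

lemma double_eq_0: "x = 0" if "x + x = 0" for x :: 'a
  using half_double[of x] that by simp

text \<open>The projection onto \<open>Ker (1 - D)\<close> parallel to \<open>Ker (1 + D)\<close>.\<close>

definition "D_projection x = smul (1/2) (x + D x)"

text \<open>The projection onto \<open>Ker (1 - D)\<close> parallel to \<open>Ker (1 + S)\<close>.\<close>

definition "oblique_projection x = D_projection (x + S x)"

lemma linear_D_projection: "Vector_Spaces.linear smul smul D_projection"
  by (unfold_locales)
    (simp_all add: D_projection_def D.add D.scale scale_right_distrib scale_left_distrib algebra_simps)

lemma linear_oblique_projection: "Vector_Spaces.linear smul smul oblique_projection"
proof -
  interpret P: Vector_Spaces.linear smul smul D_projection by (rule linear_D_projection)
  show ?thesis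
    by (unfold_locales)
      (simp_all add: oblique_projection_def S.add S.scale P.add P.scale scale_right_distrib algebra_simps)
qed

lemma D_D_projection: "D (D_projection x) = D_projection x"
  by (simp add: D_projection_def D.scale D.add D_D add.commute)

lemma D_projection_fixed: "D x = x \<Longrightarrow> D_projection x = x"
  by (simp add: D_projection_def half_double)

lemma D_projection_eq_0_iff: "D_projection x = 0 \<longleftrightarrow> x + D x = 0"
  by (simp add: D_projection_def)

lemma is_projection_D_projection:
  "is_projection smul D_projection ({x. x - D x = 0}, {x. x + D x = 0})"
  unfolding is_projection_def prod.case
proof (intro conjI linear_D_projection)
  show "D_projection \<circ> D_projection = D_projection"
    by (simp add: fun_eq_iff D_projection_fixed D_D_projection)
  show "range D_projection = {x. x - D x = 0}"
    by (auto simp: D_D_projection image_iff) (metis D_projection_fixed)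
qed (simp add: D_projection_eq_0_iff)

text \<open>
  By anticommutation \<open>S\<close> maps \<open>Ker (1 - D)\<close> into \<open>Ker (1 + D)\<close>, so the summand \<open>S x\<close> is
  killed by \<open>D_projection\<close>.
\<close>

lemma oblique_projection_fixed:
  assumes "D x = x"
  shows "oblique_projection x = x"
proof -
  have "D (S x) = - S x"
    using S_D[of x] assms by (metis minus_minus)
  then show ?thesis
    using assms by (simp add: oblique_projection_def D_projection_def D.add half_double)
qed

text \<open>\<open>Ker (1 - S)\<close>, the range of \<open>1 + S\<close>, meets \<open>Ker (1 + D)\<close> only in \<open>0\<close>.\<close>

lemma oblique_projection_eq_0_iff: "oblique_projection x = 0 \<longleftrightarrow> x + S x = 0"
proof
  define u where "u = x + S x"
  have Su: "S u = u"
    by (simp add: u_def S.add S_S add.commute)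
  assume "oblique_projection x = 0"
  then have "u + D u = 0"
    by (simp add: oblique_projection_def D_projection_eq_0_iff u_def)
  then have Du: "D u = - u"
    by (simp add: add_eq_0_iff)
  have "- u = u"
    using S_D[of u] Su Du by (simp add: S.neg)
  then have "u + u = 0"
    by (metis add.right_inverse)
  then show "x + S x = 0"
    using double_eq_0 u_def by blast
qed (simp add: oblique_projection_def D_projection_def)

lemma is_projection_oblique_projection:
  "is_projection smul oblique_projection ({x. x - D x = 0}, {x. x + S x = 0})"
  unfolding is_projection_def prod.case
proof (intro conjI linear_oblique_projection)
  have fixed: "D (oblique_projection x) = oblique_projection x" for x
    by (simp add: oblique_projection_def D_D_projection)
  show "oblique_projection \<circ> oblique_projection = oblique_projection"
    by (simp add: fun_eq_iff oblique_projection_fixed fixed)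
  show "range oblique_projection = {x. x - D x = 0}"
    by (auto simp: fixed image_iff) (metis oblique_projection_fixed)
qed (simp add: oblique_projection_eq_0_iff)

lemma swap: "anticommuting_involutions smul S D"
  by (unfold_locales) (simp_all add: D_D S_S S_D)

text \<open>
  The double projection doubles the vectors of \<open>Ker (1 - D)\<close>, so its composition with
  \<open>(1 + D) / 2\<close> is \<open>1 + D\<close>.
\<close>

lemma DV_Phi_eq:
  "DV_Phi smul ({x. x - D x = 0}, {x. x + D x = 0}) ({x. x - S x = 0}, {x. x + S x = 0}) x = x + D x"
proof -
  interpret swapped: anticommuting_involutions smul S D by (rule swap)
  define y where "y = D_projection x"
  have Dy: "D y = y"
    by (simp add: y_def D_D_projection)
  \<comment> \<open>\<open>y\<close> is sent to \<open>y + S y\<close>, which the second projection sends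
    to twice the image of \<open>y\<close>, because \<open>y + S y\<close> is fixed by \<open>S\<close>\<close>
  have "oblique_projection (swapped.oblique_projection y) = y + y"
  proof -
    have "swapped.oblique_projection y = y + S y"
      by (simp add: swapped.oblique_projection_def swapped.D_projection_def Dy S.add
          scale_right_distrib half_add_half algebra_simps)
    moreover have "oblique_projection (y + S y) = oblique_projection y + oblique_projection y"
      by (simp add: oblique_projection_def S.add S_S D_projection_def D.add scale_right_distrib algebra_simps)
    ultimately show ?thesis
      by (simp add: oblique_projection_fixed Dy)
  qed
  moreover have "y + y = x + D x"
    by (simp add: y_def D_projection_def half_add_half)
  ultimately show ?thesis
    unfolding DV_Phi_def DV_def prod.case comp_apply
      projection_along_eq[OF is_projection_D_projection]
      projection_along_eq[OF is_projection_oblique_projection]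
      projection_along_eq[OF swapped.is_projection_oblique_projection]
    by (simp add: restrict_def Dy flip: y_def)
qed

lemma negate: "anticommuting_involutions smul (\<lambda>x. - D x) (\<lambda>x. - S x)"
  by (unfold_locales) (simp_all add: D.add D.scale D.neg D_D S.add S.scale S.neg S_S S_D)

text \<open>
  The second summand exchanges the two spaces of each splitting, which amounts to replacing
  \<open>D, S\<close> by \<open>- D, - S\<close>; it is therefore \<open>1 - D\<close>.
\<close>

theorem DV_tilde_eq:
  "DV_tilde smul ({x. x - D x = 0}, {x. x + D x = 0}) ({x. x - S x = 0}, {x. x + S x = 0}) =
    (\<lambda>x. x + x)"
  using DV_Phi_eq anticommuting_involutions.DV_Phi_eq[OF negate]
  by (simp add: DV_tilde_def fun_eq_iff)

end

section \<open>Continuous linear maps of locally convex spaces are smooth\<close>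

text \<open>
  The chain rule for a linear inner map involves no derivatives of that map: the iterated
  directional derivatives of \<open>f \<circ> L\<close> are those of \<open>f\<close> at images under \<open>L\<close>.
\<close>

lemma smooth_function_comp_linear:
  fixes L :: "'a::{real_vector,topological_space} \<Rightarrow> 'b::{real_vector,topological_space}"
  assumes "linear L" "continuous_on UNIV L" "smooth_function f"
  shows "smooth_function (f \<circ> L)"
proof -
  obtain D :: "nat \<Rightarrow> 'b \<Rightarrow> (nat \<Rightarrow> 'b) \<Rightarrow> real" where
    D0: "\<And>x v. D 0 x v = f x" and
    D_Suc: "\<And>j x v. ((\<lambda>t. D j (x + t *\<^sub>R v j) v) has_real_derivative D (Suc j) x v) (at 0)" and
    D_cont: "\<And>j. continuous_on UNIV (\<lambda>(x, v). D j x v)"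
    using assms(3) unfolding smooth_function_def by blast
  have L: "L (x + t *\<^sub>R y) = L x + t *\<^sub>R L y" for x y t
    by (simp add: linear_add[OF assms(1)] linear_scale[OF assms(1)])
  have "continuous_on UNIV (\<lambda>(x, v). D j (L x) (\<lambda>i. L (v i)))" for j
  proof -
    have "continuous_on UNIV (\<lambda>z :: 'a \<times> (nat \<Rightarrow> 'a). L (fst z))"
      by (rule continuous_on_compose2[OF assms(2)]) (auto intro: continuous_intros)
    moreover have "continuous_on UNIV (\<lambda>z :: 'a \<times> (nat \<Rightarrow> 'a). L (snd z i))" for i
      by (rule continuous_on_compose2[OF assms(2)])
        (auto intro: continuous_on_product_then_coordinatewise[OF continuous_on_snd[OF continuous_on_id]])
    ultimately have "continuous_on UNIV (\<lambda>z :: 'a \<times> (nat \<Rightarrow> 'a). (L (fst z), \<lambda>i. L (snd z i)))"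
      by (intro continuous_on_Pair continuous_on_coordinatewise_then_product)
    from continuous_on_compose2[OF D_cont[of j] this] show ?thesis
      by (simp add: case_prod_beta)
  qed
  then show ?thesis
    unfolding smooth_function_def
    by (intro exI[of _ "\<lambda>j x v. D j (L x) (\<lambda>i. L (v i))"])
      (use D_Suc[of _ "L _" "\<lambda>i. L (_ i)"] in \<open>simp add: D0 L\<close>)
qed

lemma diffeo_smooth_continuous_linear:
  fixes L :: "'a::{real_vector,topological_space} \<Rightarrow> 'a"
  assumes "linear L" "continuous_on UNIV L"
  shows "diffeo_smooth lcs_diffeology lcs_diffeology L"
  unfolding diffeo_smooth_def lcs_diffeology_def comp_assoc[symmetric]
  using smooth_function_comp_linear[OF assms] by blast

section \<open>Seminorm topologies\<close>

lemma topspace_seminorm_topology [simp]: "topspace (seminorm_topology P) = UNIV"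
proof -
  have "openin (seminorm_topology P) UNIV"
    unfolding openin_seminorm_topology by (intro ballI exI[of _ "{}"] exI[of _ "1 :: real"]) simp
  then show ?thesis
    using openin_subset by blast
qed

text \<open>
  Both translations and linear maps \<open>L\<close> with \<open>q \<circ> L \<in> P\<close> for all \<open>q \<in> Q\<close> have
  this form.
\<close>

lemma continuous_map_seminorm_topology:
  assumes "\<And>q. q \<in> Q \<Longrightarrow> \<exists>p\<in>P. \<forall>x y. q (L y - L x) = p (y - x)"
  shows "continuous_map (seminorm_topology P) (seminorm_topology Q) L"
proof -
  obtain h where h: "\<And>q. q \<in> Q \<Longrightarrow> h q \<in> P" "\<And>q x y. q \<in> Q \<Longrightarrow> q (L y - L x) = h q (y - x)"
    using assms by metis
  have "openin (seminorm_topology P) (L -` U)" if U: "openin (seminorm_topology Q) U" for U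
    unfolding openin_seminorm_topology
  proof
    fix x assume "x \<in> L -` U"
    then obtain F \<epsilon> where F: "finite F" "F \<subseteq> Q" "0 < \<epsilon>" "{y. \<forall>q\<in>F. q (y - L x) < \<epsilon>} \<subseteq> U"
      using U unfolding openin_seminorm_topology by fast
    have "{y. \<forall>p\<in>h ` F. p (y - x) < \<epsilon>} \<subseteq> L -` U"
    proof
      fix y assume y: "y \<in> {y. \<forall>p\<in>h ` F. p (y - x) < \<epsilon>}"
      have "\<forall>q\<in>F. q (L y - L x) < \<epsilon>"
      proof
        fix q assume "q \<in> F"
        then show "q (L y - L x) < \<epsilon>"
          using y F(2) by (auto simp: h(2))
      qed
      then show "y \<in> L -` U"
        using F(4) by auto
    qed
    then show "\<exists>F \<epsilon>. finite F \<and> F \<subseteq> P \<and> 0 < \<epsilon> \<and> {y. \<forall>p\<in>F. p (y - x) < \<epsilon>} \<subseteq> L -` U"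
      using F h(1) by (intro exI[of _ "h ` F"] exI[of _ \<epsilon>]) auto
  qed
  then show ?thesis
    by (simp add: continuous_map vimage_def)
qed

lemma seminorm_comp_linear:
  assumes "seminorm p" "linear L"
  shows "seminorm (p \<circ> L)"
  using assms(1) by (simp add: seminorm_def linear_add[OF assms(2)] linear_scale[OF assms(2)])

text \<open>
  By the triangle inequality \<open>p\<close> varies by at most \<open>q (y - a)\<close> between \<open>a\<close> and \<open>y\<close>.  The function
  \<open>y \<mapsto> q (y - a)\<close> is continuous, because translations are continuous, and it vanishes at \<open>a\<close>.
\<close>

lemma continuous_map_dominated_seminorm:
  fixes p q :: "'a::real_vector \<Rightarrow> real"
  assumes p: "seminorm p" and le: "\<And>x. p x \<le> q x" and q0: "q 0 = 0"
    and E: "\<And>x y. x \<in> E \<Longrightarrow> y \<in> E \<Longrightarrow> x - y \<in> E"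
    and q: "continuous_map (subtopology (seminorm_topology P) E) euclideanreal q"
  shows "continuous_map (subtopology (seminorm_topology P) E) euclideanreal p"
proof -
  let ?T = "subtopology (seminorm_topology P) E"
  have "openin ?T {x \<in> topspace ?T. p x \<in> G}" if G: "open G" for G
    unfolding openin_subopen[of ?T "{x \<in> topspace ?T. p x \<in> G}"]
  proof
    fix a assume a: "a \<in> {x \<in> topspace ?T. p x \<in> G}"
    then have aE: "a \<in> E" by simp
    obtain \<epsilon> where \<epsilon>: "0 < \<epsilon>" "\<And>r. \<bar>r - p a\<bar> < \<epsilon> \<Longrightarrow> r \<in> G"
      using a G unfolding open_dist dist_real_def by blast
    have "continuous_map (seminorm_topology P) (seminorm_topology P) (\<lambda>y. y - a)"
      by (rule continuous_map_seminorm_topology) auto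
    then have "continuous_map ?T ?T (\<lambda>y. y - a)"
      using E aE by (auto simp: continuous_map_in_subtopology continuous_map_from_subtopology)
    from continuous_map_compose[OF this q] have "continuous_map ?T euclideanreal (\<lambda>y. q (y - a))"
      by (simp add: o_def)
    then have "openin ?T {y \<in> topspace ?T. q (y - a) \<in> {..<\<epsilon>}}"
      by (rule openin_continuous_map_preimage) simp
    moreover have "{y \<in> topspace ?T. q (y - a) \<in> {..<\<epsilon>}} \<subseteq> {x \<in> topspace ?T. p x \<in> G}"
    proof
      fix y assume y: "y \<in> {y \<in> topspace ?T. q (y - a) \<in> {..<\<epsilon>}}"
      have "p y \<le> p (y - a) + p a" "p a \<le> p (a - y) + p y" "p (a - y) = p (y - a)"
        using p unfolding seminorm_def
        by (metis diff_add_cancel, metis diff_add_cancel,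
            metis abs_minus_cancel abs_one minus_diff_eq mult_1 scaleR_minus1_left)
      then have "\<bar>p y - p a\<bar> < \<epsilon>"
        using y le[of "y - a"] by (simp add: abs_less_iff)
      then show "y \<in> {x \<in> topspace ?T. p x \<in> G}"
        using y \<epsilon>(2) by simp
    qed
    ultimately show "\<exists>T. openin ?T T \<and> a \<in> T \<and> T \<subseteq> {x \<in> topspace ?T. p x \<in> G}"
      using \<epsilon>(1) aE q0 by (intro exI[of _ "{y \<in> topspace ?T. q (y - a) \<in> {..<\<epsilon>}}"]) simp
  qed
  then show ?thesis
    unfolding continuous_map by (simp add: open_openin[symmetric])
qed

section \<open>Operators that preserve the continuous seminorms on formal symbols\<close>

text \<open>The seminorms that generate the inductive limit topology.\<close>

definition FCl_continuous_seminorms :: "('n::finite FCl \<Rightarrow> real) set"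
  where "FCl_continuous_seminorms =
    {p. seminorm p \<and> (\<forall>d. continuous_map (FCl_order_topology d) euclideanreal p)}"

text \<open>
  Continuity is expressed by seminorms because in this form sums are easy to treat: the
  continuity of addition is replaced by the inequality
  \<open>p (L \<sigma> + M \<sigma>) \<le> p (L \<sigma>) + p (M \<sigma>)\<close>.
\<close>

definition FCl_continuous_operator :: "('n::finite FCl \<Rightarrow> 'n FCl) \<Rightarrow> bool"
  where "FCl_continuous_operator L \<longleftrightarrow>
    linear L \<and> (\<forall>p\<in>FCl_continuous_seminorms. p \<circ> L \<in> FCl_continuous_seminorms)"

lemma diffeo_smooth_continuous_operator:
  fixes L :: "'n::finite FCl \<Rightarrow> 'n FCl"
  assumes "FCl_continuous_operator L"
  shows "diffeo_smooth lcs_diffeology lcs_diffeology L"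
proof (rule diffeo_smooth_continuous_linear)
  show L: "linear L"
    using assms by (simp add: FCl_continuous_operator_def)
  let ?Q = "FCl_continuous_seminorms :: ('n FCl \<Rightarrow> real) set"
  have "continuous_map (seminorm_topology ?Q) (seminorm_topology ?Q) L"
  proof (rule continuous_map_seminorm_topology)
    fix q assume "q \<in> ?Q"
    then have "q \<circ> L \<in> ?Q"
      using assms by (simp add: FCl_continuous_operator_def)
    moreover have "\<forall>\<sigma> \<tau>. q (L \<tau> - L \<sigma>) = (q \<circ> L) (\<tau> - \<sigma>)"
      by (simp add: linear_diff[OF L])
    ultimately show "\<exists>p\<in>?Q. \<forall>\<sigma> \<tau>. q (L \<tau> - L \<sigma>) = p (\<tau> - \<sigma>)"
      by blast
  qed
  moreover have "open U \<longleftrightarrow> openin (seminorm_topology ?Q) U" for U :: "'n FCl set"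
    by (simp add: open_FCl_def FCl_continuous_seminorms_def)
  ultimately show "continuous_on UNIV L"
    by (simp add: continuous_on_open_vimage[OF open_UNIV] continuous_map vimage_def)
qed

lemma FCl_order_diff:
  assumes "\<sigma> \<in> FCl_order d" "\<tau> \<in> FCl_order d"
  shows "\<sigma> - \<tau> \<in> FCl_order d"
  using assms unfolding FCl_order_def minus_FCl_def
  by (simp add: plus_FCl.rep_eq uminus_FCl.rep_eq del: add_uminus_conv_diff)

lemma continuous_operator_add:
  assumes "FCl_continuous_operator L" "FCl_continuous_operator M"
  shows "FCl_continuous_operator (\<lambda>\<sigma>. L \<sigma> + M \<sigma>)"
  unfolding FCl_continuous_operator_def
proof (intro conjI ballI)
  show lin: "linear (\<lambda>\<sigma>. L \<sigma> + M \<sigma>)"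
    using assms by (simp add: FCl_continuous_operator_def linear_compose_add)
  fix p :: "'a FCl \<Rightarrow> real" assume p: "p \<in> FCl_continuous_seminorms"
  then have pL: "p \<circ> L \<in> FCl_continuous_seminorms" and pM: "p \<circ> M \<in> FCl_continuous_seminorms"
    using assms by (simp_all add: FCl_continuous_operator_def)
  have sp: "seminorm p" using p by (simp add: FCl_continuous_seminorms_def)
  have "continuous_map (FCl_order_topology d) euclideanreal (p \<circ> (\<lambda>\<sigma>. L \<sigma> + M \<sigma>))" for d
    unfolding FCl_order_topology_def
  proof (rule continuous_map_dominated_seminorm[where q = "\<lambda>\<sigma>. p (L \<sigma>) + p (M \<sigma>)"])
    show "seminorm (p \<circ> (\<lambda>\<sigma>. L \<sigma> + M \<sigma>))"
      by (rule seminorm_comp_linear[OF sp lin])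
    show "(p \<circ> (\<lambda>\<sigma>. L \<sigma> + M \<sigma>)) \<sigma> \<le> p (L \<sigma>) + p (M \<sigma>)" for \<sigma>
      using sp by (simp add: seminorm_def)
    have "p (0 *\<^sub>R 0) = \<bar>0\<bar> * p 0"
      using sp unfolding seminorm_def by blast
    then show "p (L 0) + p (M 0) = 0"
      using assms by (simp add: FCl_continuous_operator_def linear_0)
    show "continuous_map (subtopology (seminorm_topology {FCl_seminorm k j s |k j s. s \<in> {1, - 1}})
        (FCl_order d)) euclideanreal (\<lambda>\<sigma>. p (L \<sigma>) + p (M \<sigma>))"
      using pL pM
      by (intro continuous_map_add)
        (simp_all add: FCl_continuous_seminorms_def FCl_order_topology_def o_def)
  qed (rule FCl_order_diff)
  then show "p \<circ> (\<lambda>\<sigma>. L \<sigma> + M \<sigma>) \<in> FCl_continuous_seminorms"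
    using seminorm_comp_linear[OF sp lin] by (simp add: FCl_continuous_seminorms_def)
qed

lemma continuous_operator_comp:
  assumes "FCl_continuous_operator L" "FCl_continuous_operator M"
  shows "FCl_continuous_operator (\<lambda>\<sigma>. L (M \<sigma>))"
  unfolding FCl_continuous_operator_def
proof (intro conjI ballI)
  have "linear M" "linear L"
    using assms by (simp_all add: FCl_continuous_operator_def)
  from linear_compose[OF this] show "linear (\<lambda>\<sigma>. L (M \<sigma>))"
    by (simp only: o_def)
  fix p :: "'a FCl \<Rightarrow> real" assume "p \<in> FCl_continuous_seminorms"
  then have "(p \<circ> L) \<circ> M \<in> FCl_continuous_seminorms"
    using assms unfolding FCl_continuous_operator_def by blast
  then show "p \<circ> (\<lambda>\<sigma>. L (M \<sigma>)) \<in> FCl_continuous_seminorms"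
    by (simp only: o_def)
qed

lemma continuous_operator_id: "FCl_continuous_operator (\<lambda>\<sigma>. \<sigma>)"
  by (simp add: FCl_continuous_operator_def o_def linear_id[unfolded id_def])

lemma continuous_operator_scaleR: "FCl_continuous_operator (\<lambda>\<sigma>. c *\<^sub>R \<sigma>)"
  unfolding FCl_continuous_operator_def
proof (intro conjI ballI)
  show lin: "linear (\<lambda>\<sigma> :: 'a FCl. c *\<^sub>R \<sigma>)"
    by (simp add: linear_iff scaleR_add_right)
  fix p :: "'a FCl \<Rightarrow> real" assume p: "p \<in> FCl_continuous_seminorms"
  then have sp: "seminorm p" by (simp add: FCl_continuous_seminorms_def)
  then have "p \<circ> (*\<^sub>R) c = (\<lambda>\<sigma>. \<bar>c\<bar> * p \<sigma>)"
    by (simp add: seminorm_def fun_eq_iff)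
  then show "p \<circ> (*\<^sub>R) c \<in> FCl_continuous_seminorms"
    using p seminorm_comp_linear[OF sp lin]
    by (auto simp: FCl_continuous_seminorms_def intro: continuous_map_real_mult_left)
qed

text \<open>
  Such an operator induces a continuous map of every \<^term>\<open>FCl_order d\<close> into itself, and a
  seminorm continuous on all of these remains so after composition with it.
\<close>

lemma continuous_operator_permuting_seminorms:
  assumes lin: "linear L"
    and order: "\<And>\<sigma> d. \<sigma> \<in> FCl_order d \<Longrightarrow> L \<sigma> \<in> FCl_order d"
    and perm: "\<And>k j s. s \<in> {1, - 1} \<Longrightarrow> \<exists>t\<in>{1, - 1}. \<forall>\<sigma>. FCl_seminorm k j s (L \<sigma>) = FCl_seminorm k j t \<sigma>"
  shows "FCl_continuous_operator L"
proof -
  let ?P = "{FCl_seminorm k j s |k j s. s \<in> {1, - 1}}"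
  have "\<exists>p\<in>?P. \<forall>\<sigma> \<tau>. q (L \<tau> - L \<sigma>) = p (\<tau> - \<sigma>)" if q: "q \<in> ?P" for q
  proof -
    obtain k j s where s: "s \<in> {1, - 1}" and q: "q = FCl_seminorm k j s"
      using q by blast
    obtain t where t: "t \<in> {1, - 1}" "\<And>\<sigma>. FCl_seminorm k j s (L \<sigma>) = FCl_seminorm k j t \<sigma>"
      using perm[OF s] by blast
    show ?thesis
    proof (rule bexI[of _ "FCl_seminorm k j t"])
      show "\<forall>\<sigma> \<tau>. q (L \<tau> - L \<sigma>) = FCl_seminorm k j t (\<tau> - \<sigma>)"
        using t(2) by (simp add: q linear_diff[OF lin, symmetric])
    qed (use t(1) in blast)
  qed
  then have "continuous_map (seminorm_topology ?P) (seminorm_topology ?P) L"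
    by (rule continuous_map_seminorm_topology)
  then have "continuous_map (FCl_order_topology d) (FCl_order_topology d) L" for d
    unfolding FCl_order_topology_def using order
    by (auto simp: continuous_map_in_subtopology continuous_map_from_subtopology)
  then have "p \<circ> L \<in> FCl_continuous_seminorms" if "p \<in> FCl_continuous_seminorms" for p
    using that seminorm_comp_linear[OF _ lin]
    by (auto simp: FCl_continuous_seminorms_def intro: continuous_map_compose)
  then show ?thesis
    using lin by (simp add: FCl_continuous_operator_def)
qed

section \<open>The two involutions permute the defining seminorms\<close>

text \<open>
  The seminorms are defined by \<^const>\<open>vector_derivative\<close>, which is homogeneous only at functions
  that are differentiable.  Smoothness of the symbols in the sense of \<^const>\<open>Ck_on\<close> provides the
  iterated derivatives along the circles on which \<open>\<xi>\<close> is constant and nonzero.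
\<close>

definition cotangent_point :: "real \<Rightarrow> real \<Rightarrow> nat \<Rightarrow> real"
  where "cotangent_point x \<xi> = (\<lambda>i. if i = 0 then x else if i = 1 then \<xi> else 0)"

lemma iterated_derivative_scaleR:
  assumes "Ck_on 2 j cotangent_domain F" "\<xi> \<noteq> 0"
  shows "((\<lambda>f x. vector_derivative f (at x)) ^^ j) (\<lambda>x. c *\<^sub>R F (cotangent_point x \<xi>)) =
    (\<lambda>x. c *\<^sub>R ((\<lambda>f x. vector_derivative f (at x)) ^^ j) (\<lambda>x. F (cotangent_point x \<xi>)) x)"
  using assms(1)
proof (induction j arbitrary: F)
  case (Suc j)
  obtain G where G: "\<And>z. z \<in> cotangent_domain \<Longrightarrow>
      ((\<lambda>t. F (z(0 := t))) has_vector_derivative G z) (at (z 0))"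
    and Ck: "Ck_on 2 j cotangent_domain G"
    using Suc.prems[unfolded Ck_on.simps] pos2 by blast
  have deriv: "((\<lambda>t. F (cotangent_point t \<xi>)) has_vector_derivative G (cotangent_point x \<xi>)) (at x)" for x
  proof -
    have "cotangent_point x \<xi> \<in> cotangent_domain"
      using assms(2) by (simp add: cotangent_point_def cotangent_domain_def topspace_Euclidean_space)
    moreover have "(cotangent_point x \<xi>)(0 := t) = cotangent_point t \<xi>" for t
      by (simp add: cotangent_point_def fun_eq_iff)
    ultimately show ?thesis
      using G[of "cotangent_point x \<xi>"] by (simp add: cotangent_point_def)
  qed
  have "(\<lambda>x. vector_derivative (\<lambda>x. F (cotangent_point x \<xi>)) (at x)) = (\<lambda>x. G (cotangent_point x \<xi>))"
    by (simp add: vector_derivative_at[OF deriv])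
  moreover have "(\<lambda>x. vector_derivative (\<lambda>x. c *\<^sub>R F (cotangent_point x \<xi>)) (at x)) =
      (\<lambda>x. c *\<^sub>R G (cotangent_point x \<xi>))"
    by (simp add: vector_derivative_at[OF
          bounded_linear.has_vector_derivative[OF bounded_linear_scaleR_right deriv]])
  ultimately show ?case
    using Suc.IH[OF Ck] by (simp add: funpow_Suc_right del: funpow.simps)
qed simp

lemma FCl_seminorm_eq:
  assumes "\<And>x. symbol_component \<tau> k x s = c *\<^sub>R symbol_component \<sigma> k x t" "\<bar>c\<bar> = 1" "t \<noteq> 0"
  shows "FCl_seminorm k j s \<tau> = FCl_seminorm k j t \<sigma>"
proof -
  have "symbol_component \<sigma> k \<in> homogeneous_symbols k"
    using symbol_component[of \<sigma>] by auto
  then have "Ck_on 2 j cotangent_domain (\<lambda>z. symbol_component \<sigma> k (z 0) (z 1))"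
    by (simp add: homogeneous_symbols_def smooth_on_def)
  from iterated_derivative_scaleR[OF this assms(3), of c] show ?thesis
    using assms(1,2) by (simp add: FCl_seminorm_def cotangent_point_def)
qed

lemma linear_of_FCl_scale_linear:
  assumes "Vector_Spaces.linear FCl_scale FCl_scale L"
  shows "linear L"
proof -
  interpret Vector_Spaces.linear FCl_scale FCl_scale L by (rule assms)
  show ?thesis
    by (rule linearI) (simp_all add: add scale flip: FCl_scale_of_real)
qed

lemma linear_s_D: "Vector_Spaces.linear FCl_scale FCl_scale s_D"
  by (intro Vector_Spaces.linear_iff[THEN iffD2] conjI vector_space_FCl_scale allI; transfer)
    (auto simp: fun_eq_iff vec_eq_iff algebra_simps)

lemma linear_s_KV: "Vector_Spaces.linear FCl_scale FCl_scale s_KV"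
  by (intro Vector_Spaces.linear_iff[THEN iffD2] conjI vector_space_FCl_scale allI; transfer)
    (auto simp: fun_eq_iff vec_eq_iff algebra_simps)

lemma continuous_operator_s_D: "FCl_continuous_operator s_D"
proof (rule continuous_operator_permuting_seminorms)
  show "linear s_D" by (rule linear_of_FCl_scale_linear[OF linear_s_D])
  show "s_D \<sigma> \<in> FCl_order d" if "\<sigma> \<in> FCl_order d" for \<sigma> d
    using that by (simp add: FCl_order_def s_D.rep_eq)
  \<comment> \<open>for \<open>s = \<plusminus>1\<close> the sign \<open>s / \<bar>s\<bar>\<close> is \<open>s\<close> itself\<close>
  show "\<exists>t\<in>{1, - 1}. \<forall>\<sigma>. FCl_seminorm k j s (s_D \<sigma>) = FCl_seminorm k j t \<sigma>" if "s \<in> {1, - 1}" for k j s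
    using that by (intro bexI[of _ s] allI FCl_seminorm_eq[where c = s]) (auto simp: s_D.rep_eq)
qed

lemma continuous_operator_s_KV: "FCl_continuous_operator s_KV"
proof (rule continuous_operator_permuting_seminorms)
  show "linear s_KV" by (rule linear_of_FCl_scale_linear[OF linear_s_KV])
  show "s_KV \<sigma> \<in> FCl_order d" if "\<sigma> \<in> FCl_order d" for \<sigma> d
    using that by (simp add: FCl_order_def s_KV.rep_eq)
  show "\<exists>t\<in>{1, - 1}. \<forall>\<sigma>. FCl_seminorm k j s (s_KV \<sigma>) = FCl_seminorm k j t \<sigma>" if "s \<in> {1, - 1}" for k j s
    using that
    by (intro bexI[of _ "- s"] allI FCl_seminorm_eq[where c = "(- 1) powi k"])
      (auto simp: s_KV.rep_eq power_int_abs)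
qed

section \<open>The two involutions anticommute\<close>

lemma symbol_component_zero_covector: "symbol_component \<sigma> k x 0 = 0"
  using symbol_component[of \<sigma>] by (auto simp: homogeneous_symbols_def)

text \<open>At \<open>\<xi> = 0\<close>, where \<open>\<xi> / \<bar>\<xi>\<bar>\<close> vanishes, this relies on the dummy value \<open>0\<close> of symbols.\<close>

lemma s_D_involutive: "s_D (s_D \<sigma>) = \<sigma>"
proof -
  have "(\<xi> / \<bar>\<xi>\<bar>) *\<^sub>R (\<xi> / \<bar>\<xi>\<bar>) *\<^sub>R symbol_component \<sigma> k x \<xi> = symbol_component \<sigma> k x \<xi>" for k x \<xi>
    by (cases "\<xi> = 0") (auto simp: symbol_component_zero_covector abs_if)
  then show ?thesis
    by (simp add: symbol_component_inject[symmetric] s_D.rep_eq fun_eq_iff)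
qed

lemma s_KV_involutive: "s_KV (s_KV \<sigma>) = \<sigma>"
  by (simp add: symbol_component_inject[symmetric] s_KV.rep_eq fun_eq_iff
      power_int_mult_distrib[symmetric])

lemma s_KV_s_D: "s_KV (s_D \<sigma>) = - s_D (s_KV \<sigma>)"
  by (simp add: symbol_component_inject[symmetric] s_KV.rep_eq s_D.rep_eq uminus_FCl.rep_eq
      fun_eq_iff mult.commute)

interpretation s_D_s_KV: anticommuting_involutions FCl_scale s_D s_KV
  by (intro anticommuting_involutions.intro anticommuting_involutions_axioms.intro
      vector_space_FCl_scale linear_s_D linear_s_KV s_D_involutive s_KV_involutive s_KV_s_D)

interpretation s_KV_s_D: anticommuting_involutions FCl_scale s_KV s_D
  by (rule s_D_s_KV.swap)

section \<open>The double projection of the two splittings\<close>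

lemma continuous_operator_half_sum:
  assumes "FCl_continuous_operator L"
  shows "FCl_continuous_operator (\<lambda>\<sigma>. FCl_scale (1/2) (\<sigma> + L \<sigma>))"
proof -
  have half: "FCl_scale (1/2) \<sigma> = (1/2) *\<^sub>R \<sigma>" for \<sigma> :: "'a FCl"
    using FCl_scale_of_real[of "1/2" \<sigma>] by simp
  then show ?thesis
    unfolding half using assms
    by (intro continuous_operator_comp[OF continuous_operator_scaleR]
      continuous_operator_add continuous_operator_id)
qed

theorem theorem51:
  shows "admissible_couple FCl_scale lcs_diffeology
           (FCl_plus, FCl_minus) (FCl_odd, FCl_even :: 'n::finite FCl set) \<and>
         DV_tilde FCl_scale (FCl_plus, FCl_minus) (FCl_odd, FCl_even) =
           (\<lambda>\<sigma> :: 'n FCl. 2 *\<^sub>R \<sigma>)"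
proof
  note continuous = continuous_operator_s_D continuous_operator_s_KV
  have half: "FCl_continuous_operator s_D_s_KV.D_projection"
    "FCl_continuous_operator s_KV_s_D.D_projection"
    unfolding s_D_s_KV.D_projection_def s_KV_s_D.D_projection_def
    by (intro continuous_operator_half_sum continuous)+
  have oblique: "FCl_continuous_operator s_D_s_KV.oblique_projection"
    "FCl_continuous_operator s_KV_s_D.oblique_projection"
    unfolding s_D_s_KV.oblique_projection_def s_KV_s_D.oblique_projection_def
    by (intro continuous_operator_comp[OF half(1)] continuous_operator_comp[OF half(2)]
        continuous_operator_add continuous_operator_id continuous)+
  note smooth = half[THEN diffeo_smooth_continuous_operator] oblique[THEN diffeo_smooth_continuous_operator]
  show "admissible_couple FCl_scale lcs_diffeology
      (FCl_plus, FCl_minus) (FCl_odd, FCl_even :: 'n FCl set)"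
    unfolding admissible_couple_def splitting_def prod.case FCl_plus_def FCl_minus_def FCl_odd_def FCl_even_def
    using smooth s_D_s_KV.is_projection_D_projection s_KV_s_D.is_projection_D_projection
      s_D_s_KV.is_projection_oblique_projection s_KV_s_D.is_projection_oblique_projection
    by blast
  show "DV_tilde FCl_scale (FCl_plus, FCl_minus) (FCl_odd, FCl_even) = (\<lambda>\<sigma> :: 'n FCl. 2 *\<^sub>R \<sigma>)"
    using s_D_s_KV.DV_tilde_eq
    by (simp add: FCl_plus_def FCl_minus_def FCl_odd_def FCl_even_def scaleR_2)
qed

end
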